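(* The automorphisms $\tau$ and $\sigma$ of $Spin(8)$ are outer automorphisms, of order $2$ and $3$ respectively, since they permute the elements of the center of $Spin(8)$, i.e. $$\sigma(-1)=\mathrm{vol}_8,\qquad \sigma(\mathrm{vol}_8)=-\mathrm{vol}_8,\qquad \sigma(-\mathrm{vol}_8)=-1,\qquad \tau(-1)=\mathrm{vol}_8,\qquad \tau(\mathrm{vol}_8)=-1.$$
   Context: $Cl_8$ is the real Clifford algebra generated by the standard basis vectors $e_1,\dots,e_8$ of $\mathbb{R}^8$ with $e_je_k=-e_ke_j$ for $j\ne k$ and $e_j^2=-1$. $Spin(8)\subset Cl_8$ is the (simply connected) Lie group of all products $x_1x_2\cdots x_{2l}$ of an even number of unit vectors $x_j\in\mathbb{R}^8$; its Lie algebra $\mathfrak{spin}(8)\subset Cl_8$ is the real span of $e_{ij}:=e_ie_j$, $1\le i<j\le 8$, with the commutator bracket. $\mathrm{vol}_8=e_1e_2\cdots e_8$. The center of $Spin(8)$ is $\{1,-1,\mathrm{vol}_8,-\mathrm{vol}_8\}$. $\sigma,\tau:Spin(8)\to Spin(8)$ are the Lie group automorphisms whose differentials at the identity are the Lie algebra automorphisms $\sigma_*,\tau_*$ of $\mathfrak{spin}(8)$ defined as follows (so $\sigma(\exp X)=\exp(\sigma_*X)$ and $\tau(\exp X)=\exp(\tau_*X)$). The linear map $\tau_*$ is given by $\tau_*(e_{ij})=\frac12 t_{ij}$ where $t_{12}=e_{12}+e_{34}+e_{56}+e_{78}$, $t_{13}=e_{13}-e_{24}+e_{57}-e_{68}$,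 $t_{14}=e_{14}+e_{23}-e_{58}-e_{67}$, $t_{15}=e_{15}-e_{26}-e_{37}+e_{48}$, $t_{16}=e_{16}+e_{25}+e_{38}+e_{47}$, $t_{17}=e_{17}-e_{28}+e_{35}-e_{46}$, $t_{18}=e_{18}+e_{27}-e_{36}-e_{45}$, $t_{23}=e_{14}+e_{23}+e_{58}+e_{67}$, $t_{24}=-e_{13}+e_{24}+e_{57}-e_{68}$, $t_{25}=e_{16}+e_{25}-e_{38}-e_{47}$, $t_{26}=-e_{15}+e_{26}-e_{37}+e_{48}$, $t_{27}=e_{18}+e_{27}+e_{36}+e_{45}$, $t_{28}=-e_{17}+e_{28}+e_{35}-e_{46}$, $t_{34}=e_{12}+e_{34}-e_{56}-e_{78}$, $t_{35}=e_{17}+e_{28}+e_{35}+e_{46}$, $t_{36}=-e_{18}+e_{27}+e_{36}-e_{45}$, $t_{37}=-e_{15}-e_{26}+e_{37}+e_{48}$, $t_{38}=e_{16}-e_{25}+e_{38}-e_{47}$, $t_{45}=-e_{18}+e_{27}-e_{36}+e_{45}$, $t_{46}=-e_{17}-e_{28}+e_{35}+e_{46}$, $t_{47}=e_{16}-e_{25}-e_{38}+e_{47}$, $t_{48}=e_{15}+e_{26}+e_{37}+e_{48}$, $t_{56}=e_{12}-e_{34}+e_{56}-e_{78}$, $t_{57}=e_{13}+e_{24}+e_{57}+e_{68}$, $t_{58}=-e_{14}+e_{23}+e_{58}-e_{67}$, $t_{67}=-e_{14}+e_{23}-e_{58}+e_{67}$, $t_{68}=-e_{13}-e_{24}+e_{57}+e_{68}$,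 $t_{78}=e_{12}-e_{34}-e_{56}+e_{78}$. The linear map $\sigma_*$ is given by $\sigma_*(e_{1k})=-\frac12 t_{1k}$ for $2\le k\le 8$ and $\sigma_*(e_{ij})=\frac12 t_{ij}$ for $2\le i<j\le 8$. *)

theory Defs
  imports "HOL-Analysis.Analysis" "HOL-Algebra.Bij" "HOL-Algebra.Multiplicative_Group"
begin

section \<open>The Clifford algebra of Euclidean 8-space\<close>

text \<open>
  An element is given by its coefficients with respect to the basis of products
  \<open>e\<^sub>A = e\<^sub>a\<^sub>1 \<dots> e\<^sub>a\<^sub>k\<close>, where \<open>A = {a\<^sub>1 < \<dots> < a\<^sub>k}\<close> is a subset of \<open>{1..8}\<close>.
\<close>

typedef cl8 = "{f :: nat set \<Rightarrow> real. \<forall>A. \<not> A \<subseteq> {1..8} \<longrightarrow> f A = 0}"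
  morphisms cl_coeff Abs_cl8
  by (intro exI[of _ "\<lambda>_. 0"]) simp

setup_lifting type_definition_cl8

lemma cl8_eqI: "(\<And>A. A \<subseteq> {1..8} \<Longrightarrow> cl_coeff x A = cl_coeff y A) \<Longrightarrow> x = y"
  by transfer (auto simp: fun_eq_iff, metis)

lemma coeff_outside: "\<not> A \<subseteq> {1..8} \<Longrightarrow> cl_coeff x A = 0"
  by transfer auto

text \<open>
  \<open>e\<^sub>A e\<^sub>B = cl_sign A B e\<^sub>C\<close> where \<open>C\<close> is the symmetric difference of \<open>A\<close> and \<open>B\<close>: reordering costs one
  sign for every pair \<open>a > b\<close>, and every \<open>a = b\<close> contributes \<open>e\<^sub>a\<^sup>2 = -1\<close>.
\<close>

definition cl_sign :: "nat set \<Rightarrow> nat set \<Rightarrow> real" where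
  "cl_sign A B = (\<Prod>a\<in>A. \<Prod>b\<in>B. if b \<le> a then - 1 else 1)"

instantiation cl8 :: real_vector
begin

lift_definition zero_cl8 :: cl8 is "\<lambda>_. 0" by simp
lift_definition plus_cl8 :: "cl8 \<Rightarrow> cl8 \<Rightarrow> cl8" is "\<lambda>x y A. x A + y A" by simp
lift_definition minus_cl8 :: "cl8 \<Rightarrow> cl8 \<Rightarrow> cl8" is "\<lambda>x y A. x A - y A" by simp
lift_definition uminus_cl8 :: "cl8 \<Rightarrow> cl8" is "\<lambda>x A. - x A" by simp
lift_definition scaleR_cl8 :: "real \<Rightarrow> cl8 \<Rightarrow> cl8" is "\<lambda>c x A. c * x A" by simp

instance
  by standard (transfer; simp add: fun_eq_iff algebra_simps)+

end

instantiation cl8 :: "{one, times}"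
begin

lift_definition one_cl8 :: cl8 is "\<lambda>A. if A = {} then 1 else 0" by auto

lift_definition times_cl8 :: "cl8 \<Rightarrow> cl8 \<Rightarrow> cl8" is
  "\<lambda>x y C. if C \<subseteq> {1..8}
     then \<Sum>A\<in>Pow {1..8}. cl_sign A (sym_diff A C) * x A * y (sym_diff A C) else 0"
  by simp

instance ..

end

lemma coeff_simps [simp]:
  "cl_coeff 0 A = 0" "cl_coeff (x + y) A = cl_coeff x A + cl_coeff y A"
  "cl_coeff (x - y) A = cl_coeff x A - cl_coeff y A" "cl_coeff (- x) A = - cl_coeff x A"
  "cl_coeff (c *\<^sub>R x) A = c * cl_coeff x A"
  by (transfer; simp)+

lemma coeff_one: "cl_coeff 1 A = (if A = {} then 1 else 0)"
  by transfer simp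

lemma coeff_times:
  "C \<subseteq> {1..8} \<Longrightarrow> cl_coeff (x * y) C =
     (\<Sum>A\<in>Pow {1..8}. cl_sign A (sym_diff A C) * cl_coeff x A * cl_coeff y (sym_diff A C))"
  by transfer simp

lemma coeff_sum [simp]: "cl_coeff (sum f S) A = (\<Sum>i\<in>S. cl_coeff (f i) A)"
  by (induction S rule: infinite_finite_induct) auto

lemma prod_sym_diff:
  fixes f :: "'a \<Rightarrow> real"
  assumes "finite A" "finite B" and "\<And>x. f x * f x = 1"
  shows "prod f (sym_diff A B) = prod f A * prod f B"
proof -
  have "prod f (sym_diff A B) = prod f (A - B) * prod f (B - A)"
    using assms by (intro prod.union_disjoint) auto
  moreover have "prod f A = prod f (A - B) * prod f (A \<inter> B)"
    using assms by (subst prod.union_disjoint[symmetric]) (auto intro!: prod.cong)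
  moreover have "prod f B = prod f (B - A) * prod f (A \<inter> B)"
    using assms by (subst prod.union_disjoint[symmetric]) (auto intro!: prod.cong)
  moreover have "prod f (A \<inter> B) * prod f (A \<inter> B) = 1"
    using assms by (simp add: prod.distrib[symmetric])
  ultimately show ?thesis by (simp add: algebra_simps)
qed

lemma cl_sign_square: "cl_sign A B * cl_sign A B = 1"
  unfolding cl_sign_def by (auto simp: prod.distrib[symmetric] intro!: prod.neutral)

lemma abs_cl_sign: "\<bar>cl_sign A B\<bar> = 1"
  using cl_sign_square[of A B] by (metis abs_mult_self_eq abs_1 abs_square_eq_1 power2_eq_square)

lemma cl_sign_sym_diff_left:
  assumes "finite A" "finite B"
  shows "cl_sign (sym_diff A B) C = cl_sign A C * cl_sign B C"
  unfolding cl_sign_def using assms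
  by (intro prod_sym_diff) (auto simp: prod.distrib[symmetric] intro!: prod.neutral)

lemma cl_sign_sym_diff_right:
  assumes "finite B" "finite C"
  shows "cl_sign A (sym_diff B C) = cl_sign A B * cl_sign A C"
proof -
  have "(\<Prod>b\<in>sym_diff B C. if b \<le> a then - 1 else (1::real)) =
        (\<Prod>b\<in>B. if b \<le> a then - 1 else 1) * (\<Prod>b\<in>C. if b \<le> a then - 1 else 1)" for a
    using assms by (intro prod_sym_diff) auto
  then show ?thesis by (simp add: cl_sign_def prod.distrib)
qed

lemma cl_sign_cocycle:
  assumes "finite A" "finite B" "finite D"
  shows "cl_sign B (sym_diff B D) * cl_sign A (sym_diff A B) =
         cl_sign A (sym_diff A D) * cl_sign (sym_diff A B) (sym_diff B D)"
proof -
  have "cl_sign A (sym_diff A D) * cl_sign (sym_diff A B) (sym_diff B D) =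
    cl_sign A A * cl_sign A B * cl_sign B B * cl_sign B D * (cl_sign A D * cl_sign A D)"
    using assms
    by (simp add: cl_sign_sym_diff_left cl_sign_sym_diff_right algebra_simps del: cl_sign_square)
  then show ?thesis
    using assms by (simp only: cl_sign_square)
      (simp add: cl_sign_sym_diff_left cl_sign_sym_diff_right algebra_simps)
qed

lemma sum_Pow_sym_diff:
  fixes f :: "nat set \<Rightarrow> real"
  assumes "A \<subseteq> S"
  shows "(\<Sum>B\<in>Pow S. f B) = (\<Sum>B\<in>Pow S. f (sym_diff A B))"
  by (rule sum.reindex_bij_witness[of _ "sym_diff A" "sym_diff A"])
    (use assms in \<open>auto intro!: arg_cong[where f = f]\<close>)

lemma cl8_mult_assoc: "x * y * z = x * (y * (z::cl8))"
proof (rule cl8_eqI)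
  fix D :: "nat set" assume D: "D \<subseteq> {1..8}"
  let ?P = "Pow {1..8::nat}"
  let ?a = "cl_coeff x" and ?b = "cl_coeff y" and ?c = "cl_coeff z"
  have sub: "sym_diff A B \<subseteq> {1..8}" if "A \<in> ?P" "B \<in> ?P" for A B using that by auto
  have "cl_coeff (x * y * z) D =
    (\<Sum>B\<in>?P. \<Sum>A\<in>?P. (cl_sign B (sym_diff B D) * cl_sign A (sym_diff A B)) *
      ?a A * ?b (sym_diff A B) * ?c (sym_diff B D))"
    using D by (simp add: coeff_times sum_distrib_left sum_distrib_right algebra_simps)
  also have "\<dots> = (\<Sum>A\<in>?P. \<Sum>B\<in>?P. (cl_sign B (sym_diff B D) * cl_sign A (sym_diff A B)) *
      ?a A * ?b (sym_diff A B) * ?c (sym_diff B D))"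
    by (rule sum.swap)
  also have "\<dots> = (\<Sum>A\<in>?P. \<Sum>B\<in>?P. (cl_sign A (sym_diff A D) *
      cl_sign (sym_diff A B) (sym_diff B D)) * ?a A * ?b (sym_diff A B) * ?c (sym_diff B D))"
    using D by (intro sum.cong refl arg_cong2[where f = "(*)"] cl_sign_cocycle)
      (auto intro: finite_subset)
  also have "\<dots> = (\<Sum>A\<in>?P. cl_sign A (sym_diff A D) * ?a A *
      (\<Sum>B\<in>?P. cl_sign (sym_diff A B) (sym_diff B D) * ?b (sym_diff A B) * ?c (sym_diff B D)))"
    by (simp add: sum_distrib_left mult_ac)
  also have "\<dots> = (\<Sum>A\<in>?P. cl_sign A (sym_diff A D) * ?a A * cl_coeff (y * z) (sym_diff A D))"
  proof (intro sum.cong refl arg_cong2[where f = "(*)"])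
    fix A assume A: "A \<in> ?P"
    have eq: "sym_diff (sym_diff A B) (sym_diff A D) = sym_diff B D" for B by auto
    have AD: "sym_diff A D \<subseteq> {1..8}" using A D by auto
    show "(\<Sum>B\<in>?P. cl_sign (sym_diff A B) (sym_diff B D) * ?b (sym_diff A B) * ?c (sym_diff B D))
        = cl_coeff (y * z) (sym_diff A D)"
      unfolding coeff_times[OF AD]
      using A by (subst (2) sum_Pow_sym_diff[of A]) (simp_all only: eq Pow_iff)
  qed
  also have "\<dots> = cl_coeff (x * (y * z)) D"
    using D by (simp add: coeff_times)
  finally show "cl_coeff (x * y * z) D = cl_coeff (x * (y * z)) D" .
qed

lemma cl_sign_empty [simp]: "cl_sign {} B = 1" "cl_sign A {} = 1"
  by (simp_all add: cl_sign_def)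

instance cl8 :: real_algebra_1
proof
  fix x y z :: cl8 and c :: real
  show "x * y * z = x * (y * z)" by (rule cl8_mult_assoc)
  show "(x + y) * z = x * z + y * z" "x * (y + z) = x * y + x * z"
    "(c *\<^sub>R x) * y = c *\<^sub>R (x * y)" "x * (c *\<^sub>R y) = c *\<^sub>R (x * y)"
    by (rule cl8_eqI, simp add: coeff_times sum.distrib sum_distrib_left algebra_simps)+
  show "1 * x = x"
  proof (rule cl8_eqI)
    fix C :: "nat set" assume C: "C \<subseteq> {1..8}"
    have "cl_coeff (1 * x) C = (\<Sum>A\<in>Pow {1..8::nat}. if A = {} then cl_coeff x C else 0)"
      unfolding coeff_times[OF C] by (intro sum.cong) (auto simp: coeff_one)
    then show "cl_coeff (1 * x) C = cl_coeff x C" by simp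
  qed
  show "x * 1 = x"
  proof (rule cl8_eqI)
    fix C :: "nat set" assume C: "C \<subseteq> {1..8}"
    have "cl_coeff (x * 1) C = (\<Sum>A\<in>Pow {1..8}. if A = C then cl_coeff x C else 0)"
      unfolding coeff_times[OF C] by (intro sum.cong) (auto simp: coeff_one)
    then show "cl_coeff (x * 1) C = cl_coeff x C" using C by simp
  qed
  have "cl_coeff (0::cl8) {} \<noteq> cl_coeff 1 {}" by (simp add: coeff_one)
  then show "(0::cl8) \<noteq> 1" by metis
qed

text \<open>
  Any norm induces the topology of the finite-dimensional algebra; this one is submultiplicative,
  so that the library's \<^const>\<open>exp\<close> is available.
\<close>

instantiation cl8 :: real_normed_algebra_1
begin

definition norm_cl8 :: "cl8 \<Rightarrow> real" where
  "norm_cl8 x = (\<Sum>A\<in>Pow {1..8}. \<bar>cl_coeff x A\<bar>)"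

definition dist_cl8 :: "cl8 \<Rightarrow> cl8 \<Rightarrow> real" where
  "dist_cl8 x y = norm (x - y)"

definition sgn_cl8 :: "cl8 \<Rightarrow> cl8" where
  "sgn_cl8 x = x /\<^sub>R norm x"

definition uniformity_cl8 :: "(cl8 \<times> cl8) filter" where
  "uniformity_cl8 = (INF e\<in>{0 <..}. principal {(x, y). dist x y < e})"

definition open_cl8 :: "cl8 set \<Rightarrow> bool" where
  "open_cl8 U = (\<forall>x\<in>U. eventually (\<lambda>(x', y). x' = x \<longrightarrow> y \<in> U) uniformity)"

instance
proof
  fix x y :: cl8 and c :: real
  show "norm x = 0 \<longleftrightarrow> x = 0"
    by (auto simp: norm_cl8_def sum_nonneg_eq_0_iff intro!: cl8_eqI)
  show "norm (x + y) \<le> norm x + norm y"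
    unfolding norm_cl8_def sum.distrib[symmetric] by (intro sum_mono) auto
  show "norm (c *\<^sub>R x) = \<bar>c\<bar> * norm x"
    by (simp add: norm_cl8_def abs_mult sum_distrib_left)
  have "norm (1::cl8) = (\<Sum>A\<in>Pow {1..8::nat}. if A = {} then 1 else 0)"
    unfolding norm_cl8_def by (intro sum.cong) (auto simp: coeff_one)
  then show "norm (1::cl8) = 1" by simp
  let ?P = "Pow {1..8::nat}"
  have "norm (x * y) \<le> (\<Sum>C\<in>?P. \<Sum>A\<in>?P. \<bar>cl_coeff x A\<bar> * \<bar>cl_coeff y (sym_diff A C)\<bar>)"
    unfolding norm_cl8_def
    by (intro sum_mono) (auto simp: coeff_times abs_mult abs_cl_sign intro!: sum_abs[THEN order_trans])
  also have "\<dots> = (\<Sum>A\<in>?P. \<bar>cl_coeff x A\<bar> * (\<Sum>C\<in>?P. \<bar>cl_coeff y (sym_diff A C)\<bar>))"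
    by (subst sum.swap) (simp add: sum_distrib_left)
  also have "\<dots> = (\<Sum>A\<in>?P. \<bar>cl_coeff x A\<bar> * norm y)"
    unfolding norm_cl8_def
    by (intro sum.cong refl arg_cong2[where f = "(*)"] sum_Pow_sym_diff[symmetric]) auto
  also have "\<dots> = norm x * norm y"
    by (simp add: norm_cl8_def sum_distrib_right)
  finally show "norm (x * y) \<le> norm x * norm y" .
qed (simp_all add: dist_cl8_def sgn_cl8_def uniformity_cl8_def open_cl8_def)

end

lemma abs_coeff_le_norm: "\<bar>cl_coeff x A\<bar> \<le> norm x"
proof (cases "A \<subseteq> {1..8}")
  case True
  then show ?thesis
    unfolding norm_cl8_def by (intro member_le_sum) auto
qed (simp add: coeff_outside)

instance cl8 :: banach
proof
  fix X :: "nat \<Rightarrow> cl8" assume X: "Cauchy X"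
  have "Cauchy (\<lambda>n. cl_coeff (X n) A)" for A
  proof (rule CauchyI)
    fix r :: real assume "0 < r"
    then obtain M where M: "\<forall>m\<ge>M. \<forall>n\<ge>M. norm (X m - X n) < r"
      using CauchyD[OF X] by blast
    have "norm (cl_coeff (X m) A - cl_coeff (X n) A) < r" if "m \<ge> M" "n \<ge> M" for m n
      using abs_coeff_le_norm[of "X m - X n" A] M that by (auto intro: order_le_less_trans)
    then show "\<exists>M. \<forall>m\<ge>M. \<forall>n\<ge>M. norm (cl_coeff (X m) A - cl_coeff (X n) A) < r" by blast
  qed
  then have "\<exists>l. (\<lambda>n. cl_coeff (X n) A) \<longlonglongrightarrow> l" for A
    using Cauchy_convergent convergent_def by blast
  then obtain l where l: "\<And>A. (\<lambda>n. cl_coeff (X n) A) \<longlonglongrightarrow> l A" by metis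
  have l0: "l A = 0" if "\<not> A \<subseteq> {1..8}" for A
    using l[of A] that by (simp add: coeff_outside LIMSEQ_const_iff)
  define L where "L = Abs_cl8 l"
  have L: "cl_coeff L A = l A" for A
    unfolding L_def using l0 by (subst Abs_cl8_inverse) auto
  have "(\<lambda>n. norm (X n - L)) \<longlonglongrightarrow> (\<Sum>A\<in>Pow {1..8::nat}. \<bar>l A - l A\<bar>)"
    unfolding norm_cl8_def coeff_simps L
    by (intro tendsto_sum tendsto_rabs tendsto_diff l tendsto_const)
  then have "X \<longlonglongrightarrow> L"
    by (simp add: LIM_zero_iff tendsto_norm_zero_iff)
  then show "convergent X" by (rule convergentI)
qed

subsection \<open>Generators\<close>

lift_definition cl_basis :: "nat set \<Rightarrow> cl8" is
  "\<lambda>A B. if A = B \<and> A \<subseteq> {1..8} then 1 else 0" by auto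

definition cl_gen :: "nat \<Rightarrow> cl8" where
  "cl_gen j = cl_basis {j}"

definition ee :: "nat \<Rightarrow> nat \<Rightarrow> cl8" where
  "ee i j = cl_gen i * cl_gen j"

definition vol8 :: cl8 where
  "vol8 = prod_list (map cl_gen [1..<9])"

lemma coeff_cl_basis: "cl_coeff (cl_basis A) B = (if A = B \<and> A \<subseteq> {1..8} then 1 else 0)"
  by transfer simp

lemma cl_basis_mult:
  assumes "A \<subseteq> {1..8}" "B \<subseteq> {1..8}"
  shows "cl_basis A * cl_basis B = cl_sign A B *\<^sub>R cl_basis (sym_diff A B)"
proof (rule cl8_eqI)
  fix C :: "nat set" assume C: "C \<subseteq> {1..8}"
  have "cl_coeff (cl_basis A * cl_basis B) C =
    (\<Sum>D\<in>Pow {1..8}. if D = A then cl_sign A B * (if sym_diff A B = C then 1 else 0) else 0)"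
    unfolding coeff_times[OF C]
  proof (intro sum.cong refl)
    fix D :: "nat set"
    have "sym_diff A C = B \<longleftrightarrow> sym_diff A B = C" by auto
    then show "cl_sign D (sym_diff D C) * cl_coeff (cl_basis A) D * cl_coeff (cl_basis B) (sym_diff D C) =
      (if D = A then cl_sign A B * (if sym_diff A B = C then 1 else 0) else 0)"
      using assms by (auto simp: coeff_cl_basis)
  qed
  also have "\<dots> = cl_sign A B * (if sym_diff A B = C then 1 else 0)"
    using assms by simp
  also have "\<dots> = cl_coeff (cl_sign A B *\<^sub>R cl_basis (sym_diff A B)) C"
    using C by (auto simp: coeff_cl_basis)
  finally show "cl_coeff (cl_basis A * cl_basis B) C =
    cl_coeff (cl_sign A B *\<^sub>R cl_basis (sym_diff A B)) C" .
qed

lemma cl_basis_expansion: "x = (\<Sum>A\<in>Pow {1..8}. cl_coeff x A *\<^sub>R cl_basis A)"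
proof (rule cl8_eqI)
  fix B :: "nat set" assume B: "B \<subseteq> {1..8}"
  have "cl_coeff (\<Sum>A\<in>Pow {1..8}. cl_coeff x A *\<^sub>R cl_basis A) B =
      (\<Sum>A\<in>Pow {1..8}. if A = B then cl_coeff x B else 0)"
    unfolding coeff_sum by (intro sum.cong) (auto simp: coeff_cl_basis)
  then show "cl_coeff x B = cl_coeff (\<Sum>A\<in>Pow {1..8}. cl_coeff x A *\<^sub>R cl_basis A) B"
    using B by simp
qed

lemma cl_gen_square: "j \<in> {1..8} \<Longrightarrow> cl_gen j * cl_gen j = - 1"
  by (intro cl8_eqI) (simp add: cl_gen_def cl_basis_mult cl_sign_def coeff_cl_basis coeff_one)

lemma cl_gen_anticommute:
  "j \<in> {1..8} \<Longrightarrow> k \<in> {1..8} \<Longrightarrow> j \<noteq> k \<Longrightarrow> cl_gen j * cl_gen k = - (cl_gen k * cl_gen j)"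
  by (intro cl8_eqI) (auto simp: cl_gen_def cl_basis_mult cl_sign_def coeff_cl_basis)

lemma cl_basis_eq_prod:
  assumes "A \<subseteq> {1..8}"
  shows "cl_basis A = prod_list (map cl_gen (sorted_list_of_set A))"
proof -
  have "cl_basis (set xs) = prod_list (map cl_gen xs)"
    if "sorted_wrt (<) xs" "set xs \<subseteq> {1..8}" for xs
    using that
  proof (induction xs)
    case Nil
    show ?case by (rule cl8_eqI) (auto simp: coeff_cl_basis coeff_one)
  next
    case (Cons a xs)
    have "cl_sign {a} (set xs) = 1"
      using Cons.prems by (auto simp: cl_sign_def intro!: prod.neutral)
    moreover have "sym_diff {a} (set xs) = set (a # xs)"
      using Cons.prems by auto
    ultimately have "cl_gen a * cl_basis (set xs) = cl_basis (set (a # xs))"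
      using Cons.prems by (simp add: cl_gen_def cl_basis_mult)
    then show ?case using Cons by simp
  qed
  from this[of "sorted_list_of_set A"] show ?thesis
    using assms finite_subset[OF assms] by simp
qed

lemma ee_eq_cl_basis: "1 \<le> i \<Longrightarrow> i < j \<Longrightarrow> j \<le> 8 \<Longrightarrow> ee i j = cl_basis {i, j}"
proof -
  assume *: "1 \<le> i" "i < j" "j \<le> 8"
  then have "sym_diff {i} {j} = {i, j}" by auto
  then show ?thesis using * by (simp add: ee_def cl_gen_def cl_basis_mult cl_sign_def)
qed

section \<open>The group Spin(8) and its Lie algebra\<close>

definition unit_vectors :: "cl8 set" where
  "unit_vectors = {\<Sum>j=1..8. v j *\<^sub>R cl_gen j | v. (\<Sum>j=1..8. (v j)\<^sup>2) = 1}"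

definition Spin8 :: "cl8 monoid" where
  "Spin8 = \<lparr>carrier = {prod_list xs | xs. set xs \<subseteq> unit_vectors \<and> even (length xs)},
            mult = (*), one = 1\<rparr>"

definition spin8 :: "cl8 set" where
  "spin8 = span {ee i j | i j. 1 \<le> i \<and> i < j \<and> j \<le> 8}"

section \<open>Automorphisms\<close>

primrec C_diff_on :: "nat \<Rightarrow> 'a set \<Rightarrow> ('a :: real_normed_vector \<Rightarrow> 'b :: real_normed_vector) \<Rightarrow> bool"
where
  "C_diff_on 0 U f \<longleftrightarrow> continuous_on U f"
| "C_diff_on (Suc k) U f \<longleftrightarrow> (\<forall>x\<in>U. f differentiable (at x)) \<and>
     (\<forall>v. C_diff_on k U (\<lambda>x. frechet_derivative f (at x) v))"

text \<open>
  Smoothness of a map on an embedded submanifold \<open>S\<close>, in terms of local extensions to the ambient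
  space.
\<close>

definition smooth_map_on :: "'a set \<Rightarrow> ('a :: real_normed_vector \<Rightarrow> 'b :: real_normed_vector) \<Rightarrow> bool"
where
  "smooth_map_on S f \<longleftrightarrow> (\<forall>x\<in>S. \<exists>U g. open U \<and> x \<in> U \<and> (\<forall>k. C_diff_on k U g) \<and>
     (\<forall>y\<in>S \<inter> U. g y = f y))"

text \<open>
  Elements of \<^term>\<open>auto G\<close> are extensional, i.e. \<^const>\<open>undefined\<close> outside the carrier.
\<close>

definition Spin8_Lie_automorphism :: "(cl8 \<Rightarrow> cl8) \<Rightarrow> bool" where
  "Spin8_Lie_automorphism f \<longleftrightarrow> f \<in> auto Spin8 \<and> smooth_map_on (carrier Spin8) f \<and>
     smooth_map_on (carrier Spin8) (inv_into (carrier Spin8) f)"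

text \<open>
  The derivative within the submanifold \<^term>\<open>carrier Spin8\<close> is determined only on its tangent space
  \<^const>\<open>spin8\<close> at the identity.
\<close>

definition has_differential_at_one :: "(cl8 \<Rightarrow> cl8) \<Rightarrow> (cl8 \<Rightarrow> cl8) \<Rightarrow> bool" where
  "has_differential_at_one f \<phi> \<longleftrightarrow>
     (\<exists>D. (f has_derivative D) (at 1 within carrier Spin8) \<and> (\<forall>X\<in>spin8. D X = \<phi> X))"

definition inner_automorphisms :: "('a, 'b) monoid_scheme \<Rightarrow> ('a \<Rightarrow> 'a) set" where
  "inner_automorphisms G =
     (\<lambda>g. \<lambda>x\<in>carrier G. g \<otimes>\<^bsub>G\<^esub> x \<otimes>\<^bsub>G\<^esub> inv\<^bsub>G\<^esub> g) ` carrier G"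

definition outer_automorphism :: "('a, 'b) monoid_scheme \<Rightarrow> ('a \<Rightarrow> 'a) \<Rightarrow> bool" where
  "outer_automorphism G f \<longleftrightarrow> f \<in> auto G \<and> f \<notin> inner_automorphisms G"

definition group_center :: "('a, 'b) monoid_scheme \<Rightarrow> 'a set" where
  "group_center G = {z \<in> carrier G. \<forall>x\<in>carrier G. z \<otimes>\<^bsub>G\<^esub> x = x \<otimes>\<^bsub>G\<^esub> z}"

section \<open>The maps on the Lie algebra\<close>

definition t_table :: "((nat \<times> nat) \<times> cl8) list" where
  "t_table =
  [((1, 2), ee 1 2 + ee 3 4 + ee 5 6 + ee 7 8),
   ((1, 3), ee 1 3 - ee 2 4 + ee 5 7 - ee 6 8),
   ((1, 4), ee 1 4 + ee 2 3 - ee 5 8 - ee 6 7),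
   ((1, 5), ee 1 5 - ee 2 6 - ee 3 7 + ee 4 8),
   ((1, 6), ee 1 6 + ee 2 5 + ee 3 8 + ee 4 7),
   ((1, 7), ee 1 7 - ee 2 8 + ee 3 5 - ee 4 6),
   ((1, 8), ee 1 8 + ee 2 7 - ee 3 6 - ee 4 5),
   ((2, 3), ee 1 4 + ee 2 3 + ee 5 8 + ee 6 7),
   ((2, 4), - ee 1 3 + ee 2 4 + ee 5 7 - ee 6 8),
   ((2, 5), ee 1 6 + ee 2 5 - ee 3 8 - ee 4 7),
   ((2, 6), - ee 1 5 + ee 2 6 - ee 3 7 + ee 4 8),
   ((2, 7), ee 1 8 + ee 2 7 + ee 3 6 + ee 4 5),
   ((2, 8), - ee 1 7 + ee 2 8 + ee 3 5 - ee 4 6),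
   ((3, 4), ee 1 2 + ee 3 4 - ee 5 6 - ee 7 8),
   ((3, 5), ee 1 7 + ee 2 8 + ee 3 5 + ee 4 6),
   ((3, 6), - ee 1 8 + ee 2 7 + ee 3 6 - ee 4 5),
   ((3, 7), - ee 1 5 - ee 2 6 + ee 3 7 + ee 4 8),
   ((3, 8), ee 1 6 - ee 2 5 + ee 3 8 - ee 4 7),
   ((4, 5), - ee 1 8 + ee 2 7 - ee 3 6 + ee 4 5),
   ((4, 6), - ee 1 7 - ee 2 8 + ee 3 5 + ee 4 6),
   ((4, 7), ee 1 6 - ee 2 5 - ee 3 8 + ee 4 7),
   ((4, 8), ee 1 5 + ee 2 6 + ee 3 7 + ee 4 8),
   ((5, 6), ee 1 2 - ee 3 4 + ee 5 6 - ee 7 8),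
   ((5, 7), ee 1 3 + ee 2 4 + ee 5 7 + ee 6 8),
   ((5, 8), - ee 1 4 + ee 2 3 + ee 5 8 - ee 6 7),
   ((6, 7), - ee 1 4 + ee 2 3 - ee 5 8 + ee 6 7),
   ((6, 8), - ee 1 3 - ee 2 4 + ee 5 7 + ee 6 8),
   ((7, 8), ee 1 2 - ee 3 4 - ee 5 6 + ee 7 8)]"

definition t_elt :: "nat \<Rightarrow> nat \<Rightarrow> cl8" where
  "t_elt i j = the (map_of t_table (i, j))"

text \<open>
  The coefficient of \<^term>\<open>ee i j\<close>, for \<open>i < j\<close>, is the one at \<open>{i, j}\<close>. The maps below are the linear
  maps on \<^const>\<open>spin8\<close> with prescribed values on the basis; they vanish on the other basis elements
  of the algebra.
\<close>

definition tau_star :: "cl8 \<Rightarrow> cl8" where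
  "tau_star X = (\<Sum>j=1..8. \<Sum>i\<in>{1..<j}. cl_coeff X {i, j} *\<^sub>R ((1/2) *\<^sub>R t_elt i j))"

definition sigma_star :: "cl8 \<Rightarrow> cl8" where
  "sigma_star X = (\<Sum>j=1..8. \<Sum>i\<in>{1..<j}. cl_coeff X {i, j} *\<^sub>R
     (if i = 1 then - ((1/2) *\<^sub>R t_elt i j) else (1/2) *\<^sub>R t_elt i j))"

lemma linear_tau_star: "linear tau_star"
  by (rule linearI) (simp_all add: tau_star_def sum.distrib scaleR_sum_right scaleR_left_distrib add_divide_distrib)

lemma linear_sigma_star: "linear sigma_star"
  by (rule linearI) (simp_all add: sigma_star_def sum.distrib scaleR_sum_right scaleR_left_distrib add_divide_distrib)

lemma sum_coeff_ee:
  assumes "1 \<le> i" "i < j" "j \<le> 8"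
  shows "(\<Sum>l=1..8. \<Sum>k\<in>{1..<l}. cl_coeff (ee i j) {k, l} *\<^sub>R f k l) = (f i j :: cl8)"
proof -
  have "(\<Sum>l=1..8. \<Sum>k\<in>{1..<l}. cl_coeff (ee i j) {k, l} *\<^sub>R f k l) =
        (\<Sum>l=1..8. \<Sum>k\<in>{1..<l}. if k = i then if l = j then f i j else 0 else 0)"
    using assms by (intro sum.cong refl) (auto simp: ee_eq_cl_basis coeff_cl_basis doubleton_eq_iff)
  also have "\<dots> = (\<Sum>l=1..8. if l = j then f i j else 0)"
    using assms by (intro sum.cong refl) auto
  finally show ?thesis using assms by simp
qed

lemma tau_star_ee: "1 \<le> i \<Longrightarrow> i < j \<Longrightarrow> j \<le> 8 \<Longrightarrow> tau_star (ee i j) = (1/2) *\<^sub>R t_elt i j"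
  unfolding tau_star_def by (rule sum_coeff_ee)

lemma sigma_star_ee_1: "2 \<le> k \<Longrightarrow> k \<le> 8 \<Longrightarrow> sigma_star (ee 1 k) = - ((1/2) *\<^sub>R t_elt 1 k)"
  unfolding sigma_star_def by (subst sum_coeff_ee) auto

lemma sigma_star_ee: "2 \<le> i \<Longrightarrow> i < j \<Longrightarrow> j \<le> 8 \<Longrightarrow> sigma_star (ee i j) = (1/2) *\<^sub>R t_elt i j"
  unfolding sigma_star_def by (subst sum_coeff_ee) auto

end

theory Submission
  imports Defs
begin

text \<open>
  A homomorphism \<open>f\<close> of \<open>Spin(8)\<close> with differential \<open>\<phi>\<close> sends the one-parameter group \<open>exp (t X)\<close> to a
  one-parameter group with initial velocity \<open>\<phi> X\<close>, and such a group in a Banach algebra can only be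
  \<open>exp (t \<phi> X)\<close> (\<open>hom_exp\<close>). So \<open>f\<close> is known on every element that lies on a one-parameter subgroup
  tangent to \<open>\<ss>\<pp>\<ii>\<nn>(8)\<close>. The product of two unit vectors is of this kind: it is a rotation in the
  plane that they span (\<open>unit_mult_eq_exp\<close>). As these products generate \<open>Spin(8)\<close>, \<open>\<phi>\<^sup>n = 1\<close> forces
  \<open>f\<^sup>n = 1\<close> (\<open>funpow_eq_id_of_differential\<close>), and the table of the \<open>t\<^sub>i\<^sub>j\<close> gives \<open>\<tau>\<^sub>*\<^sup>2 = 1\<close> and
  \<open>\<sigma>\<^sub>*\<^sup>3 = 1\<close>. Hence \<open>\<tau>\<^sup>2 = 1\<close> and \<open>\<sigma>\<^sup>3 = 1\<close>.

  The central elements are reached inside the maximal torus generated by the commuting bivectors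
  \<open>e\<^sub>1\<^sub>2, e\<^sub>3\<^sub>4, e\<^sub>5\<^sub>6, e\<^sub>7\<^sub>8\<close>. On the one hand \<open>- 1 = exp (\<pi> e\<^sub>1\<^sub>2)\<close>. On the other hand
  \<open>\<pi> \<tau>\<^sub>* e\<^sub>1\<^sub>2\<close>, \<open>\<pi> \<sigma>\<^sub>* e\<^sub>1\<^sub>2\<close> and \<open>\<pi> \<sigma>\<^sub>*\<^sup>2 e\<^sub>1\<^sub>2\<close> all have the form
  \<open>\<pi>/2 (\<plusminus> e\<^sub>1\<^sub>2 \<plusminus> e\<^sub>3\<^sub>4 \<plusminus> e\<^sub>5\<^sub>6 \<plusminus> e\<^sub>7\<^sub>8)\<close>, whose exponential is the product of the four bivectors with
  these signs, that is \<open>\<plusminus>\<close> the volume element (\<open>exp_half_pi_torus\<close>). This yields \<open>\<tau>(- 1)\<close>, \<open>\<sigma>(- 1)\<close> and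
  \<open>\<sigma>(vol\<^sub>8) = \<sigma>\<^sup>2(- 1)\<close>; the remaining values follow from \<open>\<tau>\<^sup>2 = 1\<close> and \<open>\<sigma>\<^sup>3 = 1\<close>.

  Inner automorphisms fix the centre pointwise, while \<open>- 1\<close> is moved to \<open>vol\<^sub>8 \<noteq> - 1\<close>. So \<open>\<tau>\<close> and \<open>\<sigma>\<close>
  are outer, and, being non-trivial, have the prime orders \<open>2\<close> and \<open>3\<close>.
\<close>

section \<open>One-parameter groups in Banach algebras\<close>

text \<open>
  Both \<open>\<gamma> t\<close> and \<open>exp (t X)\<close> solve \<open>y' = y X\<close>, \<open>y 0 = 1\<close>. Uniqueness is seen directly: the derivative of
  \<open>\<gamma> t exp (- t X)\<close> vanishes, because \<open>X\<close> commutes with \<open>exp (- t X)\<close>.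
\<close>

lemma one_parameter_group_eq_exp:
  fixes \<gamma> :: "real \<Rightarrow> 'a :: {real_normed_algebra_1, banach}"
  assumes add: "\<And>s t. \<gamma> (s + t) = \<gamma> s * \<gamma> t" and zero: "\<gamma> 0 = 1"
    and deriv: "(\<gamma> has_vector_derivative X) (at 0)"
  shows "\<gamma> t = exp (t *\<^sub>R X)"
proof -
  have \<gamma>': "(\<gamma> has_vector_derivative \<gamma> t * X) (at t)" for t
  proof -
    have shift: "((\<lambda>s. s - t) has_vector_derivative 1) (at t)"
      by (auto intro!: derivative_eq_intros)
    have "((\<lambda>s. \<gamma> (s - t)) has_vector_derivative X) (at t)"
      using vector_diff_chain_at[OF shift, of \<gamma> X] deriv by (simp add: o_def)
    then have "((\<lambda>s. \<gamma> t * \<gamma> (s - t)) has_vector_derivative \<gamma> t * X) (at t)"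
      by (rule has_vector_derivative_mult_right)
    then show ?thesis by (simp flip: add)
  qed
  have "((\<lambda>t. \<gamma> t * exp (t *\<^sub>R - X)) has_vector_derivative 0) (at t)" for t
    using has_vector_derivative_mult[OF \<gamma>' exp_scaleR_has_vector_derivative_right[of "- X" t]]
    by (simp add: mult.assoc exp_times_scaleR_commute[of t "- X", simplified])
  then obtain c where c: "\<And>t. \<gamma> t * exp (t *\<^sub>R - X) = c"
    using has_vector_derivative_zero_constant[of UNIV "\<lambda>t. \<gamma> t * exp (t *\<^sub>R - X)"] by auto
  have "\<gamma> t * exp (- (t *\<^sub>R X)) = 1"
    using c[of 0] c[of t] zero by simp
  then have "\<gamma> t * (exp (- (t *\<^sub>R X)) * exp (t *\<^sub>R X)) = exp (t *\<^sub>R X)"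
    by (simp flip: mult.assoc)
  then show ?thesis
    using exp_minus_inverse[of "- (t *\<^sub>R X)"] by simp
qed

text \<open>Euler's formula: \<open>1\<close> and \<open>B\<close> span a copy of the complex numbers.\<close>

lemma exp_scaleR_square_minus_one:
  fixes B :: "'a :: {real_normed_algebra_1, banach}"
  assumes "B * B = - 1"
  shows "exp (t *\<^sub>R B) = cos t *\<^sub>R 1 + sin t *\<^sub>R B"
proof (rule one_parameter_group_eq_exp[symmetric])
  show "cos (s + t) *\<^sub>R 1 + sin (s + t) *\<^sub>R B =
      (cos s *\<^sub>R 1 + sin s *\<^sub>R B) * (cos t *\<^sub>R 1 + sin t *\<^sub>R B)" for s t
    by (simp add: cos_add sin_add algebra_simps assms)
  show "((\<lambda>t. cos t *\<^sub>R 1 + sin t *\<^sub>R B) has_vector_derivative B) (at 0)"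
    by (auto intro!: derivative_eq_intros)
qed simp

lemma exp_half_pi:
  fixes B :: "'a :: {real_normed_algebra_1, banach}"
  assumes "B * B = - 1"
  shows "exp ((pi / 2) *\<^sub>R B) = B" and "exp (pi *\<^sub>R B) = - 1"
  using exp_scaleR_square_minus_one[OF assms] by simp_all

section \<open>Vectors and bivectors\<close>

definition cl_vec :: "(nat \<Rightarrow> real) \<Rightarrow> cl8" where
  "cl_vec v = (\<Sum>j=1..8. v j *\<^sub>R cl_gen j)"

lemma unit_vectors_eq: "unit_vectors = {cl_vec v | v. (\<Sum>j=1..8. (v j)\<^sup>2) = 1}"
  by (simp add: unit_vectors_def cl_vec_def)

lemma cl_vec_lincomb: "cl_vec (\<lambda>j. a * v j + b * w j) = a *\<^sub>R cl_vec v + b *\<^sub>R cl_vec w"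
  by (simp add: cl_vec_def sum.distrib scaleR_sum_right scaleR_left_distrib)

lemma cl_vec_mult: "cl_vec v * cl_vec w = (\<Sum>i=1..8. \<Sum>j=1..8. (v i * w j) *\<^sub>R ee i j)"
  unfolding cl_vec_def sum_product ee_def by (simp add: mult.commute)

lemma ee_diag: "i \<in> {1..8} \<Longrightarrow> ee i i = - 1"
  by (simp add: ee_def cl_gen_square)

lemma ee_swap: "i \<in> {1..8} \<Longrightarrow> j \<in> {1..8} \<Longrightarrow> i \<noteq> j \<Longrightarrow> ee i j = - ee j i"
  unfolding ee_def by (rule cl_gen_anticommute)

lemma subspace_spin8: "subspace spin8"
  unfolding spin8_def by (rule subspace_span)

lemma ee_in_spin8:
  assumes "i \<in> {1..8}" "j \<in> {1..8}" "i \<noteq> j"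
  shows "ee i j \<in> spin8"
proof -
  have *: "ee i j \<in> spin8" if "1 \<le> i" "i < j" "j \<le> 8" for i j
    unfolding spin8_def using that by (auto intro!: span_base)
  show ?thesis
  proof (cases "i < j")
    case False
    then have "ee j i \<in> spin8" using assms by (intro *) auto
    then show ?thesis
      using ee_swap[OF assms] by (simp add: subspace_neg subspace_spin8)
  qed (use assms * in auto)
qed

text \<open>The Clifford product of two vectors is a bivector minus their inner product.\<close>

lemma cl_vec_mult_bivector:
  "cl_vec v * cl_vec w + (\<Sum>j=1..8. v j * w j) *\<^sub>R 1 \<in> spin8"
proof -
  have "cl_vec v * cl_vec w + (\<Sum>j=1..8. v j * w j) *\<^sub>R 1 =
     (\<Sum>i=1..8. \<Sum>j=1..8. (v i * w j) *\<^sub>R ee i j + (if j = i then (v i * w j) *\<^sub>R 1 else 0))"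
    unfolding cl_vec_mult sum.distrib scaleR_sum_left by simp
  also have "\<dots> \<in> spin8"
  proof (intro subspace_sum subspace_spin8)
    fix i j :: nat assume "i \<in> {1..8}" "j \<in> {1..8}"
    then show "(v i * w j) *\<^sub>R ee i j + (if j = i then (v i * w j) *\<^sub>R 1 else 0) \<in> spin8"
      using ee_in_spin8[of i j] subspace_spin8
      by (cases "i = j") (auto simp: ee_diag subspace_0 subspace_scale)
  qed
  finally show ?thesis .
qed

lemma cl_vec_square: "cl_vec v * cl_vec v = - ((\<Sum>j=1..8. (v j)\<^sup>2) *\<^sub>R 1)"
  and cl_vec_anticommute:
    "cl_vec v * cl_vec w + cl_vec w * cl_vec v = - ((2 * (\<Sum>j=1..8. v j * w j)) *\<^sub>R 1)"
proof -
  have *: "cl_vec v * cl_vec w + cl_vec w * cl_vec v = - ((2 * (\<Sum>j=1..8. v j * w j)) *\<^sub>R 1)" for v w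
  proof -
    have "cl_vec w * cl_vec v = (\<Sum>i=1..8. \<Sum>j=1..8. (v i * w j) *\<^sub>R ee j i)"
      unfolding cl_vec_mult by (subst sum.swap) (simp add: mult.commute)
    then have "cl_vec v * cl_vec w + cl_vec w * cl_vec v =
        (\<Sum>i=1..8. \<Sum>j=1..8. (v i * w j) *\<^sub>R (ee i j + ee j i))"
      unfolding cl_vec_mult by (simp add: sum.distrib scaleR_right_distrib)
    also have "\<dots> = (\<Sum>i=1..8. \<Sum>j=1..8. if j = i then (- 2 * (v i * w j)) *\<^sub>R 1 else 0)"
    proof (intro sum.cong refl)
      fix i j :: nat assume ij: "i \<in> {1..8}" "j \<in> {1..8}"
      show "(v i * w j) *\<^sub>R (ee i j + ee j i) = (if j = i then (- 2 * (v i * w j)) *\<^sub>R 1 else 0)"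
      proof (cases "j = i")
        case True
        have "ee i i + ee i i = (- 2) *\<^sub>R 1"
          using ij by (simp add: ee_diag scaleR_2)
        then show ?thesis using True by (simp add: mult.commute)
      qed (use ij ee_swap[of i j] in simp)
    qed
    also have "\<dots> = - ((2 * (\<Sum>j=1..8. v j * w j)) *\<^sub>R 1)"
      by (simp add: sum_distrib_left scaleR_sum_left flip: sum_negf)
    finally show ?thesis .
  qed
  from *[of v w] show "cl_vec v * cl_vec w + cl_vec w * cl_vec v = - ((2 * (\<Sum>j=1..8. v j * w j)) *\<^sub>R 1)" .
  have "2 *\<^sub>R (cl_vec v * cl_vec v) = 2 *\<^sub>R (- ((\<Sum>j=1..8. (v j)\<^sup>2) *\<^sub>R 1))"
    using *[of v v] by (simp add: power2_eq_square scaleR_2)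
  then show "cl_vec v * cl_vec v = - ((\<Sum>j=1..8. (v j)\<^sup>2) *\<^sub>R 1)"
    using scaleR_left_imp_eq zero_neq_numeral by metis
qed

lemma unit_square: "x \<in> unit_vectors \<Longrightarrow> x * x = - 1"
  by (auto simp: unit_vectors_eq cl_vec_square)

lemma unit_neg:
  assumes "x \<in> unit_vectors"
  shows "- x \<in> unit_vectors"
proof -
  obtain v where "x = cl_vec v" "(\<Sum>j=1..8. (v j)\<^sup>2) = 1"
    using assms by (auto simp: unit_vectors_eq)
  moreover have "- cl_vec v = cl_vec (\<lambda>j. - v j)"
    by (simp add: cl_vec_def sum_negf)
  ultimately show ?thesis
    unfolding unit_vectors_eq by (auto intro!: exI[of _ "\<lambda>j. - v j"])
qed

section \<open>Plane rotations generate the group\<close>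

lemma carrier_Spin8:
  "carrier Spin8 = {prod_list xs | xs. set xs \<subseteq> unit_vectors \<and> even (length xs)}"
  by (simp add: Spin8_def)

lemma Spin8_simps [simp]: "x \<otimes>\<^bsub>Spin8\<^esub> y = x * y" "\<one>\<^bsub>Spin8\<^esub> = 1"
  by (simp_all add: Spin8_def)

lemma unit_mult_in_Spin8:
  assumes "x \<in> unit_vectors" "y \<in> unit_vectors"
  shows "x * y \<in> carrier Spin8"
  unfolding carrier_Spin8 using assms by (auto intro!: exI[of _ "[x, y]"])

lemma group_Spin8: "group Spin8"
proof (rule groupI)
  fix x y assume x: "x \<in> carrier Spin8" and y: "y \<in> carrier Spin8"
  from x obtain xs where xs: "x = prod_list xs" "set xs \<subseteq> unit_vectors" "even (length xs)"
    by (auto simp: carrier_Spin8)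
  from y obtain ys where ys: "y = prod_list ys" "set ys \<subseteq> unit_vectors" "even (length ys)"
    by (auto simp: carrier_Spin8)
  show "x \<otimes>\<^bsub>Spin8\<^esub> y \<in> carrier Spin8"
    using xs ys by (auto simp: carrier_Spin8 intro!: exI[of _ "xs @ ys"])
  \<comment> \<open>A unit vector \<open>x\<close> has inverse \<open>- x\<close>.\<close>
  have "prod_list (rev (map uminus xs)) * prod_list xs = 1"
    using xs(2)
  proof (induction xs)
    case (Cons a xs)
    have "a * (a * prod_list xs) = - prod_list xs"
      using Cons.prems unit_square[of a] by (simp flip: mult.assoc)
    then show ?case using Cons by (simp add: mult.assoc)
  qed simp
  moreover have "prod_list (rev (map uminus xs)) \<in> carrier Spin8"
    unfolding carrier_Spin8 using xs
    by (intro CollectI exI[of _ "rev (map uminus xs)"]) (auto simp: unit_neg subset_iff)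
  ultimately show "\<exists>z\<in>carrier Spin8. z \<otimes>\<^bsub>Spin8\<^esub> x = \<one>\<^bsub>Spin8\<^esub>"
    using xs(1) by auto
qed (auto simp: mult.assoc carrier_Spin8 intro!: exI[of _ "[]"])

text \<open>
  As a set this is the whole Lie algebra. Only the part needed to reach a set of generators of the
  group is exhibited below: the multiples of products of two orthonormal vectors.
\<close>

definition spin_directions :: "cl8 set" where
  "spin_directions = {X \<in> spin8. \<forall>t. exp (t *\<^sub>R X) \<in> carrier Spin8}"

lemma spin_directions_scaleR: "X \<in> spin_directions \<Longrightarrow> c *\<^sub>R X \<in> spin_directions"
  by (simp add: spin_directions_def subspace_scale subspace_spin8)

text \<open>
  For orthonormal \<open>x\<close> and \<open>y\<close>, the rotor \<open>exp (t x y) = cos t + sin t x y\<close> is the product of the unit vectors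
  \<open>x\<close> and \<open>- cos t x + sin t y\<close>, hence lies in the group.
\<close>

lemma orthonormal_product_direction:
  assumes v: "(\<Sum>j=1..8. (v j)\<^sup>2) = 1" and w: "(\<Sum>j=1..8. (w j)\<^sup>2) = 1"
    and orth: "(\<Sum>j=1..8. v j * w j) = 0"
  shows "(cl_vec v * cl_vec w) * (cl_vec v * cl_vec w) = - 1"
    and "cl_vec v * cl_vec w \<in> spin_directions"
proof -
  let ?x = "cl_vec v" and ?y = "cl_vec w"
  have xx: "?x * ?x = - 1" and yy: "?y * ?y = - 1" and yx: "?y * ?x = - (?x * ?y)"
    using cl_vec_square[of v] cl_vec_square[of w] cl_vec_anticommute[of v w] assms
    by (simp_all add: add_eq_0_iff)
  have "(?x * ?y) * (?x * ?y) = ?x * (?y * ?x) * ?y" by (simp add: mult.assoc)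
  also have "\<dots> = - ((?x * ?x) * (?y * ?y))" unfolding yx by (simp add: mult.assoc)
  finally show sq: "(?x * ?y) * (?x * ?y) = - 1" by (simp add: xx yy)
  have "exp (t *\<^sub>R (?x * ?y)) \<in> carrier Spin8" for t
  proof -
    let ?z = "cl_vec (\<lambda>j. - cos t * v j + sin t * w j)"
    have "(\<Sum>j=1..8. (- cos t * v j + sin t * w j)\<^sup>2) =
        (\<Sum>j=1..8. (cos t)\<^sup>2 * (v j)\<^sup>2 + (sin t)\<^sup>2 * (w j)\<^sup>2 - (2 * cos t * sin t) * (v j * w j))"
      by (intro sum.cong) (auto simp: power2_eq_square algebra_simps)
    also have "\<dots> = (cos t)\<^sup>2 + (sin t)\<^sup>2"
      using assms by (simp add: sum.distrib sum_subtractf flip: sum_distrib_left)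
    finally have "?z \<in> unit_vectors" unfolding unit_vectors_eq by auto
    moreover have "?x \<in> unit_vectors" using v unfolding unit_vectors_eq by auto
    moreover have "exp (t *\<^sub>R (?x * ?y)) = ?x * ?z"
      unfolding exp_scaleR_square_minus_one[OF sq] cl_vec_lincomb
      by (simp add: right_diff_distrib xx)
    ultimately show ?thesis using unit_mult_in_Spin8 by simp
  qed
  moreover have "?x * ?y \<in> spin8"
    using cl_vec_mult_bivector[of v w] orth by simp
  ultimately show "?x * ?y \<in> spin_directions" by (simp add: spin_directions_def)
qed

lemma ee_square: "i \<in> {1..8} \<Longrightarrow> j \<in> {1..8} \<Longrightarrow> i \<noteq> j \<Longrightarrow> ee i j * ee i j = - 1"
  and ee_direction: "i \<in> {1..8} \<Longrightarrow> j \<in> {1..8} \<Longrightarrow> i \<noteq> j \<Longrightarrow> ee i j \<in> spin_directions"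
proof -
  assume ij: "i \<in> {1..8}" "j \<in> {1..8}" "i \<noteq> j"
  \<comment> \<open>The coordinates of \<open>e\<^sub>i\<close>.\<close>
  let ?v = "\<lambda>i k. if k = i then 1 else (0::real)"
  have sum: "(\<Sum>k=1..8. (?v i k)\<^sup>2) = 1" if "i \<in> {1..8}" for i :: nat
  proof -
    have "(\<Sum>k=1..8. (?v i k)\<^sup>2) = (\<Sum>k=1..8. ?v i k)" by (intro sum.cong) auto
    then show ?thesis using that by simp
  qed
  have gen: "cl_vec (?v i) = cl_gen i" if "i \<in> {1..8}" for i
  proof -
    have "cl_vec (?v i) = (\<Sum>k=1..8. if k = i then cl_gen i else 0)"
      unfolding cl_vec_def by (intro sum.cong) auto
    then show ?thesis using that by simp
  qed
  have "(\<Sum>k=1..8. ?v i k * ?v j k) = 0"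
    using ij(3) by (intro sum.neutral) auto
  from orthonormal_product_direction[OF sum[OF ij(1)] sum[OF ij(2)] this]
  show "ee i j * ee i j = - 1" "ee i j \<in> spin_directions"
    unfolding ee_def gen[OF ij(1)] gen[OF ij(2)] by blast+
qed

text \<open>
  Write \<open>y = a x + r z\<close> with \<open>z\<close> a unit vector orthogonal to \<open>x\<close>. Then \<open>x y = - a + r x z\<close>, and \<open>a\<^sup>2 + r\<^sup>2 = 1\<close>
  makes this \<open>exp (\<theta> x z)\<close> for an angle with \<open>cos \<theta> = - a\<close> and \<open>sin \<theta> = r\<close>. If \<open>r = 0\<close>, the product is \<open>1\<close>
  or \<open>- 1 = exp (\<pi> e\<^sub>1\<^sub>2)\<close>.
\<close>

lemma unit_mult_eq_exp:
  assumes "x \<in> unit_vectors" "y \<in> unit_vectors"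
  obtains X where "X \<in> spin_directions" "x * y = exp X"
proof -
  obtain v where v: "x = cl_vec v" "(\<Sum>j=1..8. (v j)\<^sup>2) = 1"
    using assms(1) by (auto simp: unit_vectors_eq)
  obtain w where w: "y = cl_vec w" "(\<Sum>j=1..8. (w j)\<^sup>2) = 1"
    using assms(2) by (auto simp: unit_vectors_eq)
  define a where "a = (\<Sum>j=1..8. v j * w j)"
  \<comment> \<open>\<open>u\<close> is the component of \<open>w\<close> orthogonal to \<open>v\<close>, and \<open>s\<close> is its squared length.\<close>
  define u where "u j = w j - a * v j" for j
  define s where "s = (\<Sum>j=1..8. (u j)\<^sup>2)"
  have uv: "(\<Sum>j=1..8. v j * u j) = 0"
  proof -
    have "(\<Sum>j=1..8. v j * u j) = (\<Sum>j=1..8. v j * w j) - a * (\<Sum>j=1..8. (v j)\<^sup>2)"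
      unfolding sum_distrib_left sum_subtractf[symmetric]
      by (intro sum.cong) (auto simp: u_def power2_eq_square algebra_simps)
    then show ?thesis using v by (simp add: a_def)
  qed
  have s: "s = 1 - a\<^sup>2"
  proof -
    have "s = (\<Sum>j=1..8. (w j)\<^sup>2) - 2 * a * (\<Sum>j=1..8. v j * w j) + a\<^sup>2 * (\<Sum>j=1..8. (v j)\<^sup>2)"
      unfolding s_def sum_distrib_left sum_subtractf[symmetric] sum.distrib[symmetric]
      by (intro sum.cong) (auto simp: u_def power2_eq_square algebra_simps)
    then show ?thesis
      unfolding a_def[symmetric] v(2) w(2) by (simp add: power2_eq_square)
  qed
  have y: "y = a *\<^sub>R x + cl_vec u"
    using cl_vec_lincomb[of a v 1 u] unfolding v w by (simp add: u_def)
  have xx: "x * x = - 1" using assms(1) by (rule unit_square)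
  show thesis
  proof (cases "s = 0")
    case True
    then have "\<forall>j\<in>{1..8}. u j = 0"
      unfolding s_def by (subst (asm) sum_nonneg_eq_0_iff) auto
    then have "cl_vec u = 0" by (simp add: cl_vec_def)
    then have xy: "x * y = - a *\<^sub>R 1" using y xx by simp
    have "a\<^sup>2 = 1" using True s by simp
    then consider "a = 1" | "a = - 1" using power2_eq_1_iff by blast
    then show thesis
    proof cases
      case 1
      show thesis
        using that[of "pi *\<^sub>R ee 1 2"] ee_square[of 1 2] xy 1 exp_half_pi(2)[of "ee 1 2"]
        by (simp add: spin_directions_scaleR ee_direction del: One_nat_def)
    next
      case 2
      show thesis
        using that[of 0] spin_directions_scaleR[OF ee_direction[of 1 2], of 0] xy 2 by simp
    qed
  next
    case False
    define r where "r = sqrt s"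
    have "s \<ge> 0" unfolding s_def by (intro sum_nonneg) auto
    then have r: "r > 0" "r\<^sup>2 = s" using False by (auto simp: r_def)
    define z where "z j = u j / r" for j
    have z: "(\<Sum>j=1..8. (z j)\<^sup>2) = 1" "(\<Sum>j=1..8. v j * z j) = 0"
      using uv r False s_def
      unfolding z_def by (simp_all add: power_divide flip: sum_divide_distrib)
    have "cl_vec u = r *\<^sub>R cl_vec z"
      using r by (simp add: cl_vec_def z_def scaleR_sum_right)
    then have xy: "x * y = - a *\<^sub>R 1 + r *\<^sub>R (x * cl_vec z)"
      using y xx by (simp add: distrib_left)
    have "(- a)\<^sup>2 + r\<^sup>2 = 1" using s r by simp
    then obtain \<theta> where "- a = cos \<theta>" "r = sin \<theta>"
      using sincos_total_2pi by metis
    then have "x * y = exp (\<theta> *\<^sub>R (x * cl_vec z))"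
      using xy exp_scaleR_square_minus_one orthonormal_product_direction(1)[OF v(2) z]
      unfolding v(1) by metis
    then show thesis
      using that spin_directions_scaleR orthonormal_product_direction(2)[OF v(2) z]
      unfolding v(1) by blast
  qed
qed

section \<open>Homomorphisms are determined by their differential\<close>

lemma hom_exp:
  assumes f: "f \<in> hom Spin8 Spin8" and d: "has_differential_at_one f \<phi>"
    and X: "X \<in> spin_directions"
  shows "f (exp (t *\<^sub>R X)) = exp (t *\<^sub>R \<phi> X)"
proof (rule one_parameter_group_eq_exp)
  from X have car: "exp (t *\<^sub>R X) \<in> carrier Spin8" for t by (simp add: spin_directions_def)
  have "exp ((s + t) *\<^sub>R X) = exp (s *\<^sub>R X) * exp (t *\<^sub>R X)" for s t
    unfolding scaleR_left_distrib by (rule exp_add_commuting) simp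
  then show "f (exp ((s + t) *\<^sub>R X)) = f (exp (s *\<^sub>R X)) * f (exp (t *\<^sub>R X))" for s t
    using hom_mult[OF f car car] by simp
  show "f (exp (0 *\<^sub>R X)) = 1"
    using hom_one[OF f group_Spin8 group_Spin8] by simp
  obtain D where D: "(f has_derivative D) (at 1 within carrier Spin8)" "D X = \<phi> X"
    using d X unfolding has_differential_at_one_def spin_directions_def by blast
  have "((\<lambda>t. exp (t *\<^sub>R X)) has_derivative (\<lambda>h. h *\<^sub>R X)) (at 0)"
    using exp_scaleR_has_vector_derivative_right[of X 0 UNIV]
    by (simp add: has_vector_derivative_def)
  moreover have "(f has_derivative D) (at (exp (0 *\<^sub>R X)) within range (\<lambda>t. exp (t *\<^sub>R X)))"
    using D(1) car by (auto intro: has_derivative_subset)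
  ultimately have "(f \<circ> (\<lambda>t. exp (t *\<^sub>R X)) has_derivative D \<circ> (\<lambda>h. h *\<^sub>R X)) (at 0)"
    by (rule diff_chain_within)
  then show "((\<lambda>t. f (exp (t *\<^sub>R X))) has_vector_derivative \<phi> X) (at 0)"
    using D linear_scale[OF has_derivative_linear[OF D(1)]]
    by (simp add: has_vector_derivative_def o_def)
qed

lemma hom_funpow:
  assumes "f \<in> hom G G"
  shows "f ^^ n \<in> hom G G"
proof (induction n)
  case (Suc n)
  then show ?case using assms by (auto simp: hom_def Pi_def)
qed (simp add: hom_def)

text \<open>
  The iteration stays within \<^const>\<open>spin_directions\<close>: \<open>exp (t \<phi> X)\<close> lies in the group since it is
  the value of \<open>f\<close> at \<open>exp (t X)\<close>. So the \<open>n\<close>-th iterate can be treated without a chain rule for the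
  differential.
\<close>

lemma hom_funpow_exp:
  assumes f: "f \<in> hom Spin8 Spin8" and d: "has_differential_at_one f \<phi>"
    and \<phi>: "\<And>X. X \<in> spin8 \<Longrightarrow> \<phi> X \<in> spin8" and X: "X \<in> spin_directions"
  shows "(f ^^ n) (exp (t *\<^sub>R X)) = exp (t *\<^sub>R (\<phi> ^^ n) X)"
proof -
  have "(\<phi> ^^ n) X \<in> spin_directions \<and> (\<forall>t. (f ^^ n) (exp (t *\<^sub>R X)) = exp (t *\<^sub>R (\<phi> ^^ n) X))"
  proof (induction n)
    case (Suc n)
    define Y where "Y = (\<phi> ^^ n) X"
    have Y: "Y \<in> spin_directions" using Suc Y_def by simp
    have fY: "f (exp (t *\<^sub>R Y)) = exp (t *\<^sub>R \<phi> Y)" for t by (rule hom_exp[OF f d Y])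
    have "exp (t *\<^sub>R \<phi> Y) \<in> carrier Spin8" for t
      using hom_in_carrier[OF f, of "exp (t *\<^sub>R Y)"] Y fY by (simp add: spin_directions_def)
    then have "\<phi> Y \<in> spin_directions"
      using Y \<phi> by (simp add: spin_directions_def)
    then show ?case using Suc fY by (simp add: Y_def)
  qed (use X in simp)
  then show ?thesis by blast
qed

text \<open>
  An even product of unit vectors is a product of consecutive pairs, and every pair is an exponential.
\<close>

lemma hom_Spin8_eq_id:
  assumes f: "f \<in> hom Spin8 Spin8"
    and id: "\<And>X. X \<in> spin_directions \<Longrightarrow> f (exp X) = exp X"
    and g: "g \<in> carrier Spin8"
  shows "f g = g"
proof -
  have "f (prod_list xs) = prod_list xs"
    if "set xs \<subseteq> unit_vectors" "even (length xs)" for xs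
    using that
  proof (induction xs rule: induct_list012)
    case 1
    then show ?case using hom_one[OF f group_Spin8 group_Spin8] by simp
  next
    case (3 x y xs)
    have xs: "prod_list xs \<in> carrier Spin8" using 3 by (auto simp: carrier_Spin8)
    obtain X where X: "X \<in> spin_directions" "x * y = exp X"
      using unit_mult_eq_exp[of x y] 3 by auto
    have "x * y \<in> carrier Spin8" using 3 by (simp add: unit_mult_in_Spin8)
    then have "f ((x * y) * prod_list xs) = (x * y) * prod_list xs"
      using hom_mult[OF f _ xs] 3 id X by simp
    then show ?case by (simp add: mult.assoc)
  qed simp
  then show ?thesis using g by (auto simp: carrier_Spin8)
qed

lemma funpow_eq_id_of_differential:
  assumes f: "f \<in> hom Spin8 Spin8" and d: "has_differential_at_one f \<phi>"
    and \<phi>: "\<And>X. X \<in> spin8 \<Longrightarrow> \<phi> X \<in> spin8" "\<And>X. X \<in> spin8 \<Longrightarrow> (\<phi> ^^ n) X = X"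
    and g: "g \<in> carrier Spin8"
  shows "(f ^^ n) g = g"
  using hom_funpow[OF f] _ g
proof (rule hom_Spin8_eq_id)
  fix X assume "X \<in> spin_directions"
  then show "(f ^^ n) (exp X) = exp X"
    using hom_funpow_exp[OF f d \<phi>(1), of X n 1] \<phi>(2)[of X] by (simp add: spin_directions_def)
qed

section \<open>Automorphism groups\<close>

text \<open>
  Group elements are extensional functions. The iterate \<open>f ^^ n\<close> need not be one (\<open>f ^^ 0\<close> is the identity
  everywhere); hence the restriction.
\<close>

lemma AutoGroup_pow:
  assumes G: "group G" and f: "f \<in> auto G"
  shows "f [^]\<^bsub>AutoGroup G\<^esub> n = restrict (f ^^ n) (carrier G)"
proof (induction n)
  case 0
  show ?case by (simp add: AutoGroup_def BijGroup_def fun_eq_iff nat_pow_def)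
next
  case (Suc n)
  interpret A: group "AutoGroup G" by (rule group.AutoGroup[OF G])
  have fA: "f \<in> carrier (AutoGroup G)" using f by (simp add: AutoGroup_def)
  have mult: "h \<otimes>\<^bsub>AutoGroup G\<^esub> k = compose (carrier G) h k"
    if "h \<in> carrier (AutoGroup G)" "k \<in> carrier (AutoGroup G)" for h k
    using that by (simp add: AutoGroup_def BijGroup_def auto_def)
  have "f [^]\<^bsub>AutoGroup G\<^esub> Suc n = compose (carrier G) (f [^]\<^bsub>AutoGroup G\<^esub> n) f"
    unfolding A.nat_pow_Suc by (rule mult[OF A.nat_pow_closed[OF fA] fA])
  also have "\<dots> = restrict (f ^^ Suc n) (carrier G)"
    unfolding Suc funpow_Suc_right using f
    by (auto simp: compose_def fun_eq_iff auto_def Bij_imp_funcset[THEN funcset_mem])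
  finally show ?case .
qed

lemma AutoGroup_ord_prime:
  assumes G: "group G" and f: "f \<in> auto G" and p: "prime (p :: nat)"
    and id: "\<And>x. x \<in> carrier G \<Longrightarrow> (f ^^ p) x = x"
    and z: "z \<in> carrier G" "f z \<noteq> z"
  shows "group.ord (AutoGroup G) f = p"
proof -
  interpret A: group "AutoGroup G" by (rule group.AutoGroup[OF G])
  have fA: "f \<in> carrier (AutoGroup G)" using f by (simp add: AutoGroup_def)
  have one: "\<one>\<^bsub>AutoGroup G\<^esub> = (\<lambda>x\<in>carrier G. x)" by (simp add: AutoGroup_def BijGroup_def)
  have "f [^]\<^bsub>AutoGroup G\<^esub> p = \<one>\<^bsub>AutoGroup G\<^esub>"
    unfolding AutoGroup_pow[OF G f] one using id by auto
  then have "A.ord f dvd p" using A.pow_eq_id[OF fA] by simp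
  moreover have "A.ord f \<noteq> 1" using A.ord_eq_1[OF fA] z by (auto simp: one)
  ultimately show ?thesis using p by (auto simp: prime_nat_iff)
qed

text \<open>The centre is characteristic: commuting with everything is preserved and reflected by \<open>f\<close>.\<close>

lemma auto_bij_betw_center:
  assumes G: "group G" and f: "f \<in> auto G"
  shows "bij_betw f (group_center G) (group_center G)"
proof -
  interpret group G by fact
  have hom: "f (x \<otimes>\<^bsub>G\<^esub> y) = f x \<otimes>\<^bsub>G\<^esub> f y" if "x \<in> carrier G" "y \<in> carrier G" for x y
    using f that by (simp add: auto_def hom_mult)
  have inj: "inj_on f (carrier G)" and img: "f ` carrier G = carrier G"
    using f by (auto simp: auto_def Bij_def bij_betw_def)
  have iff: "f z \<in> group_center G \<longleftrightarrow> z \<in> group_center G" if z: "z \<in> carrier G" for z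
  proof -
    have "f z \<in> group_center G \<longleftrightarrow> (\<forall>x\<in>f ` carrier G. f z \<otimes>\<^bsub>G\<^esub> x = x \<otimes>\<^bsub>G\<^esub> f z)"
      using z img by (auto simp: group_center_def)
    also have "\<dots> \<longleftrightarrow> (\<forall>x\<in>carrier G. f (z \<otimes>\<^bsub>G\<^esub> x) = f (x \<otimes>\<^bsub>G\<^esub> z))"
      using z by (simp add: hom)
    also have "\<dots> \<longleftrightarrow> z \<in> group_center G"
      using z inj by (auto simp: group_center_def inj_on_eq_iff)
    finally show ?thesis .
  qed
  have sub: "group_center G \<subseteq> carrier G" by (auto simp: group_center_def)
  have "y \<in> f ` group_center G" if y: "y \<in> group_center G" for y
  proof -
    obtain z where "z \<in> carrier G" "y = f z" using y sub img by blast
    then show ?thesis using iff y by blast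
  qed
  then have "f ` group_center G = group_center G"
    using iff sub by blast
  then show ?thesis
    using inj_on_subset[OF inj sub] by (simp add: bij_betw_def)
qed

lemma outer_automorphism_if_moves_center:
  assumes G: "group G" and f: "f \<in> auto G" and z: "z \<in> group_center G" "f z \<noteq> z"
  shows "outer_automorphism G f"
proof -
  interpret group G by fact
  have "f \<notin> inner_automorphisms G"
  proof
    assume "f \<in> inner_automorphisms G"
    then obtain g where g: "g \<in> carrier G" "f = (\<lambda>x\<in>carrier G. g \<otimes>\<^bsub>G\<^esub> x \<otimes>\<^bsub>G\<^esub> inv\<^bsub>G\<^esub> g)"
      by (auto simp: inner_automorphisms_def)
    have zG: "z \<in> carrier G" using z by (simp add: group_center_def)
    have "f z = g \<otimes>\<^bsub>G\<^esub> z \<otimes>\<^bsub>G\<^esub> inv\<^bsub>G\<^esub> g" using g zG by simp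
    also have "g \<otimes>\<^bsub>G\<^esub> z = z \<otimes>\<^bsub>G\<^esub> g" using g z by (simp add: group_center_def)
    also have "z \<otimes>\<^bsub>G\<^esub> g \<otimes>\<^bsub>G\<^esub> inv\<^bsub>G\<^esub> g = z" using g zG by (simp add: m_assoc)
    finally show False using z by simp
  qed
  then show ?thesis using f by (simp add: outer_automorphism_def)
qed

section \<open>The orders of the two Lie algebra maps\<close>

lemma t_elt_table: "list_all (\<lambda>((i, j), x). t_elt i j = x) t_table"
  by (simp add: t_elt_def t_table_def)

lemmas t_elt_values = t_elt_table[unfolded t_table_def list.pred_inject(2) prod.case]

lemma map_fst_t_table: "map fst t_table = [(1, 2), (1, 3), (1, 4), (1, 5), (1, 6), (1, 7), (1, 8),
  (2, 3), (2, 4), (2, 5), (2, 6), (2, 7), (2, 8), (3, 4), (3, 5), (3, 6), (3, 7), (3, 8),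
  (4, 5), (4, 6), (4, 7), (4, 8), (5, 6), (5, 7), (5, 8), (6, 7), (6, 8), (7, 8)]"
  by (simp add: t_table_def)

lemma index_in_table:
  assumes "1 \<le> i" "i < j" "j \<le> (8::nat)"
  shows "(i, j) \<in> set (map fst t_table)"
proof -
  have "i \<in> {1, 2, 3, 4, 5, 6, 7}" "j \<in> {2, 3, 4, 5, 6, 7, 8}" using assms by auto
  then show ?thesis using assms(2) unfolding map_fst_t_table by (elim insertE emptyE; simp)
qed

lemmas tau_star_linear_simps =
  linear_add[OF linear_tau_star] linear_diff[OF linear_tau_star]
  linear_neg[OF linear_tau_star] linear_scale[OF linear_tau_star]

lemmas sigma_star_linear_simps =
  linear_add[OF linear_sigma_star] linear_diff[OF linear_sigma_star]
  linear_neg[OF linear_sigma_star] linear_scale[OF linear_sigma_star]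

text \<open>
  In the next two lemmas the goal is compared coefficientwise, so that it becomes a linear identity between
  real numbers. The simplifier must not turn the index \<open>1\<close> into \<^term>\<open>Suc 0\<close>, which would no longer match
  the table.
\<close>

lemma tau_star_tau_star_ee:
  assumes "1 \<le> i" "i < j" "j \<le> 8"
  shows "tau_star (tau_star (ee i j)) = ee i j"
proof -
  have "list_all (\<lambda>(i, j). tau_star (tau_star (ee i j)) = ee i j) (map fst t_table)"
    unfolding map_fst_t_table list.pred_inject(2) prod.case
    by (intro conjI list.pred_inject(1); rule cl8_eqI;
      simp del: One_nat_def add: t_elt_values tau_star_ee tau_star_linear_simps;
      simp add: field_simps)
  then show ?thesis using index_in_table[OF assms] unfolding list_all_iff by blast
qed

lemma sigma_star_sigma_star_sigma_star_ee:
  assumes "1 \<le> i" "i < j" "j \<le> 8"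
  shows "sigma_star (sigma_star (sigma_star (ee i j))) = ee i j"
proof -
  have "list_all (\<lambda>(i, j). sigma_star (sigma_star (sigma_star (ee i j))) = ee i j) (map fst t_table)"
    unfolding map_fst_t_table list.pred_inject(2) prod.case
    by (intro conjI list.pred_inject(1); rule cl8_eqI;
      simp del: One_nat_def add: t_elt_values sigma_star_ee sigma_star_ee_1 sigma_star_linear_simps;
      simp add: field_simps)
  then show ?thesis using index_in_table[OF assms] unfolding list_all_iff by blast
qed

lemma t_elt_in_spin8:
  assumes "1 \<le> i" "i < j" "j \<le> 8"
  shows "t_elt i j \<in> spin8"
proof -
  have "list_all (\<lambda>(i, j). t_elt i j \<in> spin8) (map fst t_table)"
    unfolding map_fst_t_table list.pred_inject(2) prod.case
    by (intro conjI list.pred_inject(1);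
      simp del: One_nat_def add: t_elt_values subspace_spin8 subspace_add subspace_diff subspace_neg ee_in_spin8)
  then show ?thesis using index_in_table[OF assms] unfolding list_all_iff by blast
qed

lemma tau_star_in_spin8: "tau_star X \<in> spin8"
  unfolding tau_star_def
  by (intro subspace_sum subspace_scale subspace_spin8 t_elt_in_spin8) auto

lemma sigma_star_in_spin8: "sigma_star X \<in> spin8"
  unfolding sigma_star_def
  by (auto intro!: subspace_sum subspace_neg subspace_scale[OF subspace_spin8] subspace_spin8 t_elt_in_spin8)

lemma tau_star_involution: "X \<in> spin8 \<Longrightarrow> (tau_star ^^ 2) X = X"
proof -
  assume "X \<in> spin8"
  then have "(tau_star \<circ> tau_star) X = id X"
    unfolding spin8_def
    by (rule linear_eq_on_span[rotated 3],
        (intro linear_compose linear_tau_star linear_id)+) (auto simp: tau_star_tau_star_ee)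
  then show ?thesis by (simp add: numeral_2_eq_2)
qed

lemma sigma_star_cube: "X \<in> spin8 \<Longrightarrow> (sigma_star ^^ 3) X = X"
proof -
  assume "X \<in> spin8"
  then have "(sigma_star \<circ> (sigma_star \<circ> sigma_star)) X = id X"
    unfolding spin8_def
    by (rule linear_eq_on_span[rotated 3],
        (intro linear_compose linear_sigma_star linear_id)+)
      (auto simp: sigma_star_sigma_star_sigma_star_ee)
  then show ?thesis by (simp add: numeral_3_eq_3)
qed

section \<open>The maximal torus and the centre\<close>

lemma ee_commute:
  assumes "distinct [i, j, k, l]" "{i, j, k, l} \<subseteq> {1..8}"
  shows "ee i j * ee k l = ee k l * ee i j"
proof -
  have gen: "ee i j * cl_gen m = cl_gen m * ee i j" if "m \<in> {k, l}" for m
  proof -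
    have jm: "cl_gen j * cl_gen m = - (cl_gen m * cl_gen j)"
      and im: "cl_gen i * cl_gen m = - (cl_gen m * cl_gen i)"
      using that assms by (auto intro!: cl_gen_anticommute)
    have "ee i j * cl_gen m = - (cl_gen i * cl_gen m) * cl_gen j"
      by (simp add: ee_def mult.assoc jm)
    then show ?thesis by (simp add: im ee_def mult.assoc)
  qed
  have "ee i j * ee k l = cl_gen k * (ee i j * cl_gen l)"
    using gen[of k] by (simp add: ee_def[of k l] flip: mult.assoc)
  then show ?thesis using gen[of l] by (simp add: ee_def[of k l] mult.assoc)
qed

lemma vol8_eq_ee: "vol8 = ee 1 2 * ee 3 4 * ee 5 6 * ee 7 8"
  by (simp add: vol8_def ee_def upt_rec mult.assoc eval_nat_numeral)

text \<open>
  The four summands commute, so the exponential factorizes; each \<open>\<plusminus> e\<^sub>i\<^sub>j\<close> squares to \<open>- 1\<close> and is its own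
  exponential at time \<open>\<pi>/2\<close>.
\<close>

lemma exp_half_pi_torus:
  assumes "a\<^sup>2 = 1" "b\<^sup>2 = 1" "c\<^sup>2 = 1" "d\<^sup>2 = 1"
  shows "exp ((pi / 2) *\<^sub>R (a *\<^sub>R ee 1 2 + b *\<^sub>R ee 3 4 + c *\<^sub>R ee 5 6 + d *\<^sub>R ee 7 8)) =
    (a * b * c * d) *\<^sub>R vol8"
proof -
  have e: "exp ((pi / 2) *\<^sub>R (r *\<^sub>R ee i j)) = r *\<^sub>R ee i j"
    if "i \<in> {1..8}" "j \<in> {1..8}" "i \<noteq> j" "r\<^sup>2 = 1" for r i j
    using that by (intro exp_half_pi(1)) (simp add: ee_square power2_eq_square)
  have comm: "ee 5 6 * ee 7 8 = ee 7 8 * ee 5 6" "ee 3 4 * ee 7 8 = ee 7 8 * ee 3 4"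
    "ee 1 2 * ee 7 8 = ee 7 8 * ee 1 2" "ee 3 4 * ee 5 6 = ee 5 6 * ee 3 4"
    "ee 1 2 * ee 5 6 = ee 5 6 * ee 1 2" "ee 1 2 * ee 3 4 = ee 3 4 * ee 1 2"
    by (rule ee_commute; simp)+
  define A where "A = (pi / 2) *\<^sub>R (a *\<^sub>R ee 1 2)"
  define B where "B = (pi / 2) *\<^sub>R (b *\<^sub>R ee 3 4)"
  define C where "C = (pi / 2) *\<^sub>R (c *\<^sub>R ee 5 6)"
  define D where "D = (pi / 2) *\<^sub>R (d *\<^sub>R ee 7 8)"
  have AB: "A * B = B * A" and ABC: "(A + B) * C = C * (A + B)"
    and ABCD: "(A + B + C) * D = D * (A + B + C)"
    unfolding A_def B_def C_def D_def
    by (simp_all add: distrib_left distrib_right scaleR_right_distrib comm mult.commute del: One_nat_def)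
  have "exp (A + B + C + D) = exp A * exp B * exp C * exp D"
    by (simp add: exp_add_commuting AB ABC ABCD)
  also have "\<dots> = (a * b * c * d) *\<^sub>R vol8"
    using e[OF _ _ _ assms(1), of 1 2] e[OF _ _ _ assms(2), of 3 4]
      e[OF _ _ _ assms(3), of 5 6] e[OF _ _ _ assms(4), of 7 8]
    unfolding A_def[symmetric] B_def[symmetric] C_def[symmetric] D_def[symmetric]
    by (simp add: vol8_eq_ee mult_ac del: One_nat_def)
  finally show ?thesis by (simp add: A_def B_def C_def D_def scaleR_right_distrib)
qed

lemma coeff_vol8_empty: "cl_coeff vol8 {} = 0"
proof -
  have vol8: "vol8 = cl_basis {1..<9}"
    by (subst cl_basis_eq_prod) (auto simp: vol8_def simp del: upt_Suc)
  show ?thesis unfolding vol8 coeff_cl_basis by auto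
qed

lemma vol8_neq_minus_one: "vol8 \<noteq> - 1"
proof -
  have "cl_coeff (- 1) {} \<noteq> 0" by (simp add: coeff_one)
  then show ?thesis using coeff_vol8_empty by metis
qed

lemma exp_pi_ee_12: "exp (pi *\<^sub>R ee 1 2) = - 1"
  by (rule exp_half_pi(2)) (simp add: ee_square)

lemma minus_one_in_center: "- 1 \<in> group_center Spin8"
proof -
  have "ee 1 2 \<in> spin_directions" by (rule ee_direction) auto
  then have "- 1 \<in> carrier Spin8" unfolding exp_pi_ee_12[symmetric] by (simp add: spin_directions_def)
  then show ?thesis by (simp add: group_center_def)
qed

section \<open>Action on the centre\<close>

theorem corollary4p8:
  fixes \<sigma> \<tau> :: "cl8 \<Rightarrow> cl8"
  assumes "Spin8_Lie_automorphism \<sigma>" and "has_differential_at_one \<sigma> sigma_star"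
    and "Spin8_Lie_automorphism \<tau>" and "has_differential_at_one \<tau> tau_star"
  shows "outer_automorphism Spin8 \<tau> \<and> outer_automorphism Spin8 \<sigma> \<and>
    group.ord (AutoGroup Spin8) \<tau> = 2 \<and> group.ord (AutoGroup Spin8) \<sigma> = 3 \<and>
    bij_betw \<tau> (group_center Spin8) (group_center Spin8) \<and>
    bij_betw \<sigma> (group_center Spin8) (group_center Spin8) \<and>
    \<sigma> (- 1) = vol8 \<and> \<sigma> vol8 = - vol8 \<and> \<sigma> (- vol8) = - 1 \<and>
    \<tau> (- 1) = vol8 \<and> \<tau> vol8 = - 1"
proof -
  have \<sigma>: "\<sigma> \<in> auto Spin8" "\<sigma> \<in> hom Spin8 Spin8" and \<tau>: "\<tau> \<in> auto Spin8" "\<tau> \<in> hom Spin8 Spin8"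
    using assms(1,3) by (auto simp: Spin8_Lie_automorphism_def auto_def)
  have \<sigma>_cube: "(\<sigma> ^^ 3) g = g" if "g \<in> carrier Spin8" for g
    by (rule funpow_eq_id_of_differential[OF \<sigma>(2) assms(2) sigma_star_in_spin8 sigma_star_cube that])
  have \<tau>_square: "(\<tau> ^^ 2) g = g" if "g \<in> carrier Spin8" for g
    by (rule funpow_eq_id_of_differential[OF \<tau>(2) assms(4) tau_star_in_spin8 tau_star_involution that])
  have e12: "ee 1 2 \<in> spin_directions" by (rule ee_direction) auto
  have m1: "- 1 \<in> carrier Spin8" using minus_one_in_center by (simp add: group_center_def)
  have "\<tau> (- 1) = exp (pi *\<^sub>R tau_star (ee 1 2))"
    using hom_exp[OF \<tau>(2) assms(4) e12, of pi] by (simp only: exp_pi_ee_12)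
  also have "pi *\<^sub>R tau_star (ee 1 2) =
      (pi / 2) *\<^sub>R (1 *\<^sub>R ee 1 2 + 1 *\<^sub>R ee 3 4 + 1 *\<^sub>R ee 5 6 + 1 *\<^sub>R ee 7 8)"
    by (simp add: tau_star_ee t_elt_values del: One_nat_def)
  finally have \<tau>_minus_one: "\<tau> (- 1) = vol8" by (subst (asm) exp_half_pi_torus) simp_all
  \<comment> \<open>\<open>\<tau> vol\<^sub>8 = \<tau>\<^sup>2 (- 1)\<close>.\<close>
  have \<tau>_vol: "\<tau> vol8 = - 1" using \<tau>_square[OF m1] by (simp add: numeral_2_eq_2 \<tau>_minus_one)
  have "\<sigma> (- 1) = exp (pi *\<^sub>R sigma_star (ee 1 2))"
    using hom_exp[OF \<sigma>(2) assms(2) e12, of pi] by (simp only: exp_pi_ee_12)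
  also have "pi *\<^sub>R sigma_star (ee 1 2) =
      (pi / 2) *\<^sub>R ((- 1) *\<^sub>R ee 1 2 + (- 1) *\<^sub>R ee 3 4 + (- 1) *\<^sub>R ee 5 6 + (- 1) *\<^sub>R ee 7 8)"
    by (simp add: sigma_star_ee_1 t_elt_values algebra_simps del: One_nat_def)
  finally have \<sigma>_minus_one: "\<sigma> (- 1) = vol8" by (subst (asm) exp_half_pi_torus) simp_all
  have "\<sigma> vol8 = (\<sigma> ^^ 2) (- 1)" by (simp add: numeral_2_eq_2 \<sigma>_minus_one)
  also have "\<dots> = exp (pi *\<^sub>R sigma_star (sigma_star (ee 1 2)))"
    using hom_funpow_exp[OF \<sigma>(2) assms(2) sigma_star_in_spin8 e12, of 2 pi]
    unfolding exp_pi_ee_12 by (simp add: numeral_2_eq_2)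
  also have "pi *\<^sub>R sigma_star (sigma_star (ee 1 2)) =
      (pi / 2) *\<^sub>R ((- 1) *\<^sub>R ee 1 2 + 1 *\<^sub>R ee 3 4 + 1 *\<^sub>R ee 5 6 + 1 *\<^sub>R ee 7 8)"
    by (rule cl8_eqI)
      (simp add: sigma_star_ee_1 sigma_star_ee t_elt_values sigma_star_linear_simps
        del: One_nat_def; simp add: field_simps)
  finally have \<sigma>_vol: "\<sigma> vol8 = - vol8" by (subst (asm) exp_half_pi_torus) simp_all
  \<comment> \<open>\<open>\<sigma> (- vol\<^sub>8) = \<sigma>\<^sup>3 (- 1)\<close>.\<close>
  have \<sigma>_mvol: "\<sigma> (- vol8) = - 1"
    using \<sigma>_cube[OF m1] by (simp add: numeral_3_eq_3 \<sigma>_minus_one \<sigma>_vol)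
  show ?thesis
    using outer_automorphism_if_moves_center[OF group_Spin8 _ minus_one_in_center]
      AutoGroup_ord_prime[OF group_Spin8 \<tau>(1) two_is_prime_nat \<tau>_square m1]
      AutoGroup_ord_prime[OF group_Spin8 \<sigma>(1) _ \<sigma>_cube m1] auto_bij_betw_center[OF group_Spin8]
      vol8_neq_minus_one \<sigma> \<tau> \<sigma>_minus_one \<sigma>_vol \<sigma>_mvol \<tau>_minus_one \<tau>_vol
    by simp
qed

end
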